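(* For all integers $a, b \geq 1$, $\sigma(K_{a,b} \boxtimes K_{a,b}) \geq ab$, where $K_{a,b}$ is the complete bipartite graph with parts of sizes $a$ and $b$.
   Context: Surrounding Cops and Robbers on a finite simple graph $G$ with $k \geq 1$ cops and one robber: the cops first choose starting vertices (several cops may share a vertex), then the robber chooses a starting vertex not occupied by a cop, and thereafter the cops and the robber alternate moves, the cops moving first. In a move, each player may move to an adjacent vertex or stay put; the robber may never move to, or remain on, a vertex occupied by a cop, so if a cop moves onto the robber's vertex the robber is compelled to move to a neighbouring vertex not occupied by a cop. The cops win if at any time every neighbour of the robber's vertex is occupied by a cop; the robber wins if he avoids this forever. Play is with perfect information. The surrounding cop number $\sigma(G)$ is the least number of cops for which the cops have a winning strategy. The strong product $G \boxtimes H$ has vertex set $V(G)\times V(H)$, with distinct $(g,h)$ and $(g',h')$ adjacent iff ($g=g'$ or $gg'\in E(G)$) and ($h=h'$ or $hh'\in E(H)$). *)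

theory Defs
  imports "Graph_Theory.Graph_Theory"
begin

text \<open>
  A finite simple graph is a symmetric digraph satisfying the locale \<^locale>\<open>graph\<close>; an edge
  between \<open>u\<close> and \<open>v\<close> is the pair of arcs \<open>(u, v)\<close> and \<open>(v, u)\<close>.
\<close>

definition strong_product ::
    "('a, 'b) pre_digraph \<Rightarrow> ('c, 'd) pre_digraph \<Rightarrow> ('a \<times> 'c) pair_pre_digraph"
    (infixl \<open>\<boxtimes>\<close> 70) where
  "G \<boxtimes> H = \<lparr>
     pverts = verts G \<times> verts H,
     parcs = {((g, h), (g', h')).
       (g, h) \<in> verts G \<times> verts H \<and> (g', h') \<in> verts G \<times> verts H \<and> (g, h) \<noteq> (g', h') \<and>
       (g = g' \<or> g \<rightarrow>\<^bsub>G\<^esub> g') \<and> (h = h' \<or> h \<rightarrow>\<^bsub>H\<^esub> h')} \<rparr>"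

definition step :: "('v, 'e) pre_digraph \<Rightarrow> 'v \<Rightarrow> 'v \<Rightarrow> bool" where
  "step G u v \<longleftrightarrow> v = u \<or> u \<rightarrow>\<^bsub>G\<^esub> v"

text \<open>
  A placement of \<open>k\<close> cops is a list of \<open>k\<close> vertices, repetitions allowed. A strategy of the cops
  sends the list of all vertices chosen by the robber so far, oldest first, to the placement that
  the cops take next: \<open>S []\<close> is the starting placement and \<open>S [r\<^sub>0, \<dots>, r\<^sub>n]\<close> the placement
  after the cops have responded to \<open>r\<^sub>n\<close>. The earlier placements are determined by \<open>S\<close> and the
  prefixes of that list, so this is the full history of the play.
\<close>

definition cop_strategy ::
    "('v, 'e) pre_digraph \<Rightarrow> nat \<Rightarrow> ('v list \<Rightarrow> 'v list) \<Rightarrow> bool" where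
  "cop_strategy G k S \<longleftrightarrow>
     (\<forall>rs. set rs \<subseteq> verts G \<longrightarrow> length (S rs) = k \<and> set (S rs) \<subseteq> verts G) \<and>
     (\<forall>rs r. set rs \<subseteq> verts G \<longrightarrow> r \<in> verts G \<longrightarrow> list_all2 (step G) (S rs) (S (rs @ [r])))"

text \<open>
  The placement of the cops when the robber, who plays \<open>r 0, r 1, \<dots>\<close>, is about to choose \<open>r n\<close>.
\<close>

definition cops_at :: "('v list \<Rightarrow> 'v list) \<Rightarrow> (nat \<Rightarrow> 'v) \<Rightarrow> nat \<Rightarrow> 'v list" where
  "cops_at S r n = S (map r [0..<n])"

text \<open>
  If a cop has moved onto \<open>r n\<close>, the last condition rules out \<open>r (Suc n) = r n\<close>, so the robber is
  forced to a neighbour free of cops.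
\<close>

definition robber_play ::
    "('v, 'e) pre_digraph \<Rightarrow> ('v list \<Rightarrow> 'v list) \<Rightarrow> (nat \<Rightarrow> 'v) \<Rightarrow> bool" where
  "robber_play G S r \<longleftrightarrow>
     r 0 \<in> verts G \<and>
     (\<forall>n. step G (r n) (r (Suc n))) \<and>
     (\<forall>n. r n \<notin> set (cops_at S r n))"

definition surrounded :: "('v, 'e) pre_digraph \<Rightarrow> 'v list \<Rightarrow> 'v \<Rightarrow> bool" where
  "surrounded G C v \<longleftrightarrow> (\<forall>w. v \<rightarrow>\<^bsub>G\<^esub> w \<longrightarrow> w \<in> set C)"

text \<open>
  The two disjuncts are the positions after the robber's choice of \<open>r n\<close> and after the cops'
  response to it. Only infinite plays of the robber need to be considered: as long as he is not
  surrounded he has a legal move (see \<open>not_surrounded_imp_move\<close> below), so a play in which he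
  gets stuck is one in which he has been surrounded.
\<close>

definition winning_cop_strategy ::
    "('v, 'e) pre_digraph \<Rightarrow> nat \<Rightarrow> ('v list \<Rightarrow> 'v list) \<Rightarrow> bool" where
  "winning_cop_strategy G k S \<longleftrightarrow>
     cop_strategy G k S \<and>
     (\<forall>r. robber_play G S r \<longrightarrow>
        (\<exists>n. surrounded G (cops_at S r n) (r n) \<or> surrounded G (cops_at S r (Suc n)) (r n)))"

definition surrounding_cop_number :: "('v, 'e) pre_digraph \<Rightarrow> nat" where
  "surrounding_cop_number G = (LEAST k. 1 \<le> k \<and> (\<exists>S. winning_cop_strategy G k S))"

lemma not_surrounded_imp_move:
  "\<not> surrounded G C v \<Longrightarrow> \<exists>w. step G v w \<and> w \<notin> set C"
  by (auto simp: surrounded_def step_def)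

text \<open>
  The minimum in \<^const>\<open>surrounding_cop_number\<close> is over a nonempty set: with a cop on every vertex
  the robber has nowhere to start.
\<close>

lemma winning_cop_strategy_exists:
  assumes "finite (verts G)" "verts G \<noteq> {}"
  shows "\<exists>k\<ge>1. \<exists>S. winning_cop_strategy G k S"
proof -
  obtain xs where xs: "set xs = verts G" "distinct xs"
    using assms(1) finite_distinct_list by blast
  then have "length xs \<ge> 1" using assms(2) by (cases xs) auto
  moreover have "winning_cop_strategy G (length xs) (\<lambda>_. xs)"
    using xs by (auto simp: winning_cop_strategy_def cop_strategy_def robber_play_def cops_at_def
        step_def intro!: list.rel_refl)
  ultimately show ?thesis by blast
qed

lemma strong_product_graph:
  assumes "graph G" "graph H"
  shows "graph (G \<boxtimes> H)"
proof -
  interpret G: graph G by fact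
  interpret H: graph H by fact
  have sub: "parcs (G \<boxtimes> H) \<subseteq> (verts G \<times> verts H) \<times> (verts G \<times> verts H)"
    by (auto simp: strong_product_def)
  have "sym (parcs (G \<boxtimes> H))"
    using arcs_ends_symmetric[OF G.sym_arcs] arcs_ends_symmetric[OF H.sym_arcs]
    by (auto simp: strong_product_def sym_def)
  moreover have "finite (parcs (G \<boxtimes> H))"
    using finite_subset[OF sub] by simp
  ultimately interpret pair_graph "G \<boxtimes> H"
    by unfold_locales (auto simp: strong_product_def symmetric_def)
  show ?thesis by unfold_locales
qed

end

theory Submission
  imports Defs
begin

text \<open>
  If every vertex of a nonempty vertex set \<open>U\<close> has more than \<open>k\<close> neighbours inside \<open>U\<close>, then
  \<open>k\<close> cops can never cover the neighbours of a robber who stays in \<open>U\<close>, so he always has a free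
  vertex of \<open>U\<close> to move to. In the strong square of the complete bipartite graph with parts
  \<open>X\<close> and \<open>Y\<close>, the set \<open>X \<times> Y \<union> Y \<times> X\<close> has this property for \<open>k < ab\<close>, because every vertex
  of \<open>X \<times> Y\<close> is adjacent to every vertex of \<open>Y \<times> X\<close>.
\<close>

lemma robber_play_avoiding_surround:
  fixes G :: "('v, 'e) pre_digraph"
  assumes strat: "cop_strategy G k S"
    and U: "finite U" "U \<subseteq> verts G" "U \<noteq> {}"
    and deg: "\<And>u. u \<in> U \<Longrightarrow> k < card {w \<in> U. u \<rightarrow>\<^bsub>G\<^esub> w}"
  obtains r where "robber_play G S r"
    and "\<And>n. \<not> surrounded G (cops_at S r n) (r n)"
    and "\<And>n. \<not> surrounded G (cops_at S r (Suc n)) (r n)"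
proof -
  have len: "length (S rs) = k" if "set rs \<subseteq> U" for rs
    using strat that U by (auto simp: cop_strategy_def)
  have free_neighbour: "\<exists>w\<in>U. u \<rightarrow>\<^bsub>G\<^esub> w \<and> w \<notin> set (S rs)" if "u \<in> U" "set rs \<subseteq> U" for u rs
  proof (rule ccontr)
    assume "\<not> ?thesis"
    then have "{w \<in> U. u \<rightarrow>\<^bsub>G\<^esub> w} \<subseteq> set (S rs)" by blast
    then have "card {w \<in> U. u \<rightarrow>\<^bsub>G\<^esub> w} \<le> card (set (S rs))" by (simp add: card_mono)
    also have "\<dots> \<le> k" using card_length[of "S rs"] len[OF that(2)] by simp
    finally show False using deg[OF that(1)] by simp
  qed
  \<comment> \<open>The robber never stays put, so a cop landing on his vertex needs no separate
    case. The guard \<open>rs \<noteq> []\<close> frees his first choice from adjacency,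
    \<open>last []\<close> being unspecified.\<close>
  define move where "move rs = (SOME w. w \<in> U \<and> w \<notin> set (S rs) \<and>
    (rs \<noteq> [] \<longrightarrow> last rs \<rightarrow>\<^bsub>G\<^esub> w))" for rs
  have move: "move rs \<in> U \<and> move rs \<notin> set (S rs) \<and> (rs \<noteq> [] \<longrightarrow> last rs \<rightarrow>\<^bsub>G\<^esub> move rs)"
    if rs: "set rs \<subseteq> U" for rs
  proof -
    obtain u0 where "u0 \<in> U" using U(3) by blast
    \<comment> \<open>For the empty history \<open>u0\<close> plays the previous vertex, so that
      \<open>free_neighbour\<close> also yields a free starting vertex.\<close>
    define u where "u = (if rs = [] then u0 else last rs)"
    have "u \<in> U" using rs \<open>u0 \<in> U\<close> last_in_set[of rs] by (auto simp: u_def)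
    then obtain w where "w \<in> U" "u \<rightarrow>\<^bsub>G\<^esub> w" "w \<notin> set (S rs)"
      using free_neighbour[OF _ rs] by blast
    then have "w \<in> U \<and> w \<notin> set (S rs) \<and> (rs \<noteq> [] \<longrightarrow> last rs \<rightarrow>\<^bsub>G\<^esub> w)"
      by (auto simp: u_def)
    then show ?thesis unfolding move_def by (rule someI)
  qed
  \<comment> \<open>\<open>S\<close> reads whole histories, so the recursion runs on the list of
    choices; the play \<open>r\<close> is read off it afterwards.\<close>
  define hist where "hist = rec_nat [] (\<lambda>_ rs. rs @ [move rs])"
  have hist_0: "hist 0 = []" and hist_Suc: "hist (Suc n) = hist n @ [move (hist n)]" for n
    by (simp_all add: hist_def)
  have hist_U: "set (hist n) \<subseteq> U" for n
    by (induction n) (simp_all add: hist_0 hist_Suc move)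
  define r where "r n = move (hist n)" for n
  have hist_eq: "map r [0..<n] = hist n" for n
    by (induction n) (simp_all add: hist_0 hist_Suc r_def)
  have r_U: "r n \<in> U" for n using move[OF hist_U] by (simp add: r_def)
  have "r n \<rightarrow>\<^bsub>G\<^esub> r (Suc n)" for n
    using move[OF hist_U[of "Suc n"]] by (simp add: r_def hist_Suc)
  moreover have "r n \<notin> set (cops_at S r n)" for n
    using move[OF hist_U] unfolding cops_at_def hist_eq by (simp add: r_def)
  ultimately have "robber_play G S r"
    using r_U U(2) by (auto simp: robber_play_def step_def)
  \<comment> \<open>The counting bound holds for the placement after any history in
    \<open>U\<close>, so the times \<open>m\<close> and \<open>n\<close> are independent;
    \<open>m = n\<close> and \<open>m = Suc n\<close> are the cases needed.\<close>
  moreover have "\<not> surrounded G (cops_at S r m) (r n)" for m n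
    using free_neighbour[OF r_U hist_U] unfolding surrounded_def cops_at_def hist_eq by blast
  ultimately show ?thesis by (intro that)
qed

text \<open>A winning strategy exists for some number of cops, so the least such number is attained.
  Were it below \<open>d\<close>, the robber's play inside \<open>U\<close> would defeat that
  strategy.\<close>

theorem surrounding_cop_number_ge_min_degree_within:
  fixes G :: "('v, 'e) pre_digraph"
  assumes "finite (verts G)" "U \<subseteq> verts G" "U \<noteq> {}"
    and deg: "\<And>u. u \<in> U \<Longrightarrow> d \<le> card {w \<in> U. u \<rightarrow>\<^bsub>G\<^esub> w}"
  shows "d \<le> surrounding_cop_number G"
proof (rule ccontr)
  let ?k = "surrounding_cop_number G"
  assume "\<not> d \<le> ?k"
  then have deg': "?k < card {w \<in> U. u \<rightarrow>\<^bsub>G\<^esub> w}" if "u \<in> U" for u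
    using deg[OF that] by simp
  have "verts G \<noteq> {}" using assms by blast
  then have "\<exists>k\<ge>1. \<exists>S. winning_cop_strategy G k S"
    using assms(1) by (rule winning_cop_strategy_exists[rotated])
  then have "\<exists>S. winning_cop_strategy G ?k S"
    unfolding surrounding_cop_number_def by (rule LeastI2_ex) blast
  then obtain S where S: "winning_cop_strategy G ?k S" ..
  then have "cop_strategy G ?k S" by (simp add: winning_cop_strategy_def)
  then obtain r where "robber_play G S r"
    and "\<And>n. \<not> surrounded G (cops_at S r n) (r n)"
    and "\<And>n. \<not> surrounded G (cops_at S r (Suc n)) (r n)"
    using robber_play_avoiding_surround[of G ?k S U] finite_subset[OF assms(2,1)] assms(2,3) deg'
    by blast
  with S show False by (auto simp: winning_cop_strategy_def)
qed

theorem theorem21: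
  fixes G :: "('v, 'e) pre_digraph" and a b :: nat
  assumes "a \<ge> 1" and "b \<ge> 1"
    and "K\<^bsub>a,b\<^esub> G"
  shows "surrounding_cop_number (G \<boxtimes> G) \<ge> a * b"
proof -
  from assms(3) obtain X Y where verts: "verts G = X \<union> Y" and disj: "X \<inter> Y = {}"
    and card: "card X = a" "card Y = b" and arcs: "arcs_ends G = X \<times> Y \<union> Y \<times> X"
    unfolding complete_bipartite_digraph_def by blast
  \<comment> \<open>Infinite sets have cardinality 0, so positive part sizes force
    finiteness.\<close>
  have fin: "finite X" "finite Y" and ne: "X \<noteq> {}" "Y \<noteq> {}"
    using card assms(1,2) by (auto intro: card_ge_0_finite)
  let ?U = "X \<times> Y \<union> Y \<times> X"
  \<comment> \<open>In each coordinate the two vertices lie in opposite parts, hence are adjacent;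
    disjointness of the parts makes the pairs distinct.\<close>
  have adj: "u \<rightarrow>\<^bsub>G \<boxtimes> G\<^esub> w"
    if "u \<in> X \<times> Y \<and> w \<in> Y \<times> X \<or> u \<in> Y \<times> X \<and> w \<in> X \<times> Y" for u w
    using that disj by (auto simp: strong_product_def verts arcs)
  show ?thesis
  proof (rule surrounding_cop_number_ge_min_degree_within)
    show "finite (verts (G \<boxtimes> G))" "?U \<subseteq> verts (G \<boxtimes> G)"
      using fin by (auto simp: strong_product_def verts)
    show "?U \<noteq> {}" using ne by blast
  next
    fix u assume "u \<in> ?U"
    then have "Y \<times> X \<subseteq> {w \<in> ?U. u \<rightarrow>\<^bsub>G \<boxtimes> G\<^esub> w} \<or> X \<times> Y \<subseteq> {w \<in> ?U. u \<rightarrow>\<^bsub>G \<boxtimes> G\<^esub> w}"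
      using adj by blast
    moreover have "card (Y \<times> X) = a * b" "card (X \<times> Y) = a * b"
      using card by (simp_all add: card_cartesian_product)
    moreover have "finite {w \<in> ?U. u \<rightarrow>\<^bsub>G \<boxtimes> G\<^esub> w}" using fin by simp
    ultimately show "a * b \<le> card {w \<in> ?U. u \<rightarrow>\<^bsub>G \<boxtimes> G\<^esub> w}"
      using card_mono[of "{w \<in> ?U. u \<rightarrow>\<^bsub>G \<boxtimes> G\<^esub> w}" "X \<times> Y"]
        card_mono[of "{w \<in> ?U. u \<rightarrow>\<^bsub>G \<boxtimes> G\<^esub> w}" "Y \<times> X"] by argo
  qed
qed

end
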